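(* Let $b\ge 2$ be an integer and let $W$ be a non-negative random variable with $\mathbb{E}[W]=1$ whose distribution is not that of $W_{TC}$. Let $(Y_n)_{n\ge 1}$ be the Mandelbrot cascade martingale associated with $W$ and $b$. Let $q>1$ be real. (1) (Subcritical case) If $\mathbb{E}[W^q]<b^{q-1}$, then $\sup_{n}\mathbb{E}[Y_n^q]<\infty$. (2) (Supercritical case) If $\mathbb{E}[W^q]>b^{q-1}$, then $$\liminf_{n\to\infty}\frac{\log\mathbb{E}[Y_n^q]}{n}\ge \log\frac{\mathbb{E}[W^q]}{b^{q-1}},$$ and if moreover $1<q\le 2$, then $$\lim_{n\to\infty}\frac{\log\mathbb{E}[Y_n^q]}{n}= \log\frac{\mathbb{E}[W^q]}{b^{q-1}}.$$
   Context: $W_{TC}$ denotes the random variable with $\mathbb{P}(W_{TC}=b)=b^{-1}$ and $\mathbb{P}(W_{TC}=0)=1-b^{-1}$. Let $W(j_1,\dots,j_m)$, for $m\ge 1$ and $j_1,\dots,j_m\in\{0,\dots,b-1\}$, be independent copies of $W$ indexed by all non-empty finite words over $\{0,\dots,b-1\}$. The Mandelbrot cascade martingale is $$Y_n = b^{-n}\sum_{j_1,\dots,j_n\in\{0,\dots,b-1\}} W(j_1)W(j_1,j_2)\cdots W(j_1,j_2,\dots,j_n),\qquad n\ge 1.$$ *)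

theory Defs
  imports "HOL-Probability.Probability"
begin

text \<open>A word \<open>(j\<^sub>1, \<dots>, j\<^sub>m)\<close> is a list of numbers below \<open>b\<close>, with \<open>j\<^sub>1\<close> at its head.\<close>

definition words_of_length :: "nat \<Rightarrow> nat \<Rightarrow> nat list set" where
  "words_of_length b n = {j. length j = n \<and> set j \<subseteq> {..<b}}"

definition nonempty_words :: "nat \<Rightarrow> nat list set" where
  "nonempty_words b = {j. j \<noteq> [] \<and> set j \<subseteq> {..<b}}"

text \<open>Equality in law is equality of the image measures on the Borel sets. The copies may
  live on a probability space other than that of \<open>W\<close>.\<close>

definition independent_copies ::
    "'b measure \<Rightarrow> ('i \<Rightarrow> 'b \<Rightarrow> real) \<Rightarrow> 'i set \<Rightarrow> 'a measure \<Rightarrow> ('a \<Rightarrow> real) \<Rightarrow> bool" where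
  "independent_copies M V I N W \<longleftrightarrow>
     prob_space.indep_vars M (\<lambda>_. borel) V I \<and>
     (\<forall>i\<in>I. distr M borel (V i) = distr N borel W)"

definition W_TC_law :: "nat \<Rightarrow> real measure" where
  "W_TC_law b =
     distr (measure_pmf (bernoulli_pmf (1 / real b))) borel (\<lambda>c. if c then real b else 0)"

definition cascade :: "nat \<Rightarrow> (nat list \<Rightarrow> 'b \<Rightarrow> real) \<Rightarrow> nat \<Rightarrow> 'b \<Rightarrow> real" where
  "cascade b V n \<omega> =
     (\<Sum>j\<in>words_of_length b n. \<Prod>m=1..n. V (take m j) \<omega>) / real b ^ n"

text \<open>The \<open>q\<close>-th moment of an almost surely non-negative random variable, possibly infinite.\<close>

definition moment :: "'a measure \<Rightarrow> ('a \<Rightarrow> real) \<Rightarrow> real \<Rightarrow> ennreal" where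
  "moment M X q = (\<integral>\<^sup>+ \<omega>. ennreal (X \<omega> powr q) \<partial>M)"

text \<open>The natural logarithm from \<open>[0, \<infinity>]\<close> to \<open>[-\<infinity>, \<infinity>]\<close>.\<close>

definition ext_ln :: "ennreal \<Rightarrow> ereal" where
  "ext_ln x = (if x = 0 then - \<infinity> else if x = \<infinity> then \<infinity> else ereal (ln (enn2real x)))"

end

theory Submission
  imports Defs "HOL-Real_Asymp.Real_Asymp"
begin

text \<open>Splitting the words of length \<open>n + 1\<close> by their first letter gives
  \<open>b Y\<^sub>n\<^sub>+\<^sub>1 = \<Sum>\<^sub>j X\<^sub>j\<close> with \<open>X\<^sub>j = W(j) Y\<^sub>n\<^sup>(\<^sup>j\<^sup>)\<close>, where \<open>Y\<^sub>n\<^sup>(\<^sup>j\<^sup>)\<close> is the cascade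
  of the subtree below \<open>j\<close>. The \<open>X\<^sub>j\<close> are independent with mean 1, and
  \<open>E[X\<^sub>j\<^sup>q] = E[W\<^sup>q] E[Y\<^sub>n\<^sup>q]\<close>. The number that governs the moments is
  \<open>\<rho>(q) = E[W\<^sup>q] / b\<^sup>q\<^sup>-\<^sup>1\<close>, called \<open>growth q\<close> below.

  Lower bound. Since \<open>(\<Sum> x\<^sub>j)\<^sup>q \<ge> \<Sum> x\<^sub>j\<^sup>q\<close>, one generation multiplies the moment by at least
  \<open>\<rho>(q)\<close>, so \<open>E[Y\<^sub>n\<^sup>q] \<ge> \<rho>(q)\<^sup>n\<close>; this is \<open>growth_power_le_moment_cascade\<close>.

  Upper bound. Write \<open>S = \<Sum> X\<^sub>j\<close>. Then \<open>S\<^sup>q = \<Sum> X\<^sub>j S\<^sup>q\<^sup>-\<^sup>1\<close>, and \<open>S\<close> is the sum of \<open>X\<^sub>j\<close> and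
  a remainder independent of \<open>X\<^sub>j\<close>. An inequality
  \<open>(a + c)\<^sup>q\<^sup>-\<^sup>1 \<le> K a\<^sup>q\<^sup>-\<^sup>1 + C c\<^sup>q\<^sup>-\<^sup>1\<close> therefore turns into
  \<open>E[Y\<^sub>n\<^sub>+\<^sub>1\<^sup>q] \<le> K \<rho>(q) E[Y\<^sub>n\<^sup>q] + C E[Y\<^sub>n\<^sub>+\<^sub>1\<^sup>q\<^sup>-\<^sup>1]\<close>, which is \<open>moment_cascade_Suc_le\<close>.
  It is used in two ways.

  If \<open>\<rho>(q) < 1\<close>, take \<open>K > 1\<close> with \<open>K \<rho>(q) < 1\<close>. Then the \<open>q\<close>-th moments are bounded as
  soon as the \<open>(q - 1)\<close>-th ones are, and \<open>\<rho>(q) < 1\<close> passes to all smaller exponents above 1 by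
  convexity (\<open>growth_less_1_downward\<close>). Lowering the exponent by 1 leads to an
  exponent at most 1, where moments are at most 1.

  If \<open>1 < q \<le> 2\<close>, then \<open>K = C = 1\<close> is possible and the \<open>(q - 1)\<close>-th moments are at most 1. For
  \<open>\<rho>(q) \<ge> 1\<close> this gives \<open>E[Y\<^sub>n\<^sup>q] \<le> (n + 1) \<rho>(q)\<^sup>n\<close>, which has the exponential rate of the
  lower bound.\<close>

section \<open>Elementary power inequalities\<close>

text \<open>A part \<open>t\<close> of \<open>s = a + c\<close> satisfies \<open>t / s \<le> (t / s)\<^sup>p\<close>, and the two fractions add
  up to 1.\<close>

lemma powr_add_le_add_powr:
  fixes a c p :: real
  assumes "0 \<le> a" "0 \<le> c" "0 < p" "p \<le> 1"
  shows "(a + c) powr p \<le> a powr p + c powr p"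
proof (cases "a + c = 0")
  case False
  define s where "s = a + c"
  have s: "s > 0" using False assms by (simp add: s_def)
  have frac: "t / s * s powr p \<le> t powr p" if "0 \<le> t" "t \<le> s" for t
  proof -
    have "t / s \<le> (t / s) powr p"
      using powr_mono'[of p 1 "t / s"] that s assms by (simp add: field_simps)
    hence "t / s * s powr p \<le> (t / s) powr p * s powr p"
      by (intro mult_right_mono) auto
    also have "\<dots> = t powr p"
      using that s by (simp add: powr_divide)
    finally show ?thesis .
  qed
  have "a / s + c / s = 1"
    using s by (simp add: s_def flip: add_divide_distrib)
  hence "s powr p = a / s * s powr p + c / s * s powr p"
    by (metis distrib_right mult_1)
  also have "\<dots> \<le> a powr p + c powr p"
    using assms by (intro add_mono frac) (auto simp: s_def)
  finally show ?thesis by (simp add: s_def)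
qed (use assms in auto)

text \<open>For exponents above 1 the constant \<open>K = 1\<close> is lost, but \<open>K\<close> can be as close to 1 as
  wanted: if \<open>c\<close> is small relative to \<open>a\<close>, the first term suffices, and otherwise \<open>a\<close> is at
  most a multiple of \<open>c\<close>.\<close>

lemma powr_add_le_almost_add_powr:
  fixes p K :: real
  assumes "0 < p" "1 < K"
  obtains C where "0 \<le> C"
    "\<And>a c :: real. 0 \<le> a \<Longrightarrow> 0 \<le> c \<Longrightarrow> (a + c) powr p \<le> K * a powr p + C * c powr p"
proof -
  \<comment> \<open>The threshold ratio at which the first term alone is an exact bound.\<close>
  define d where "d = K powr (1 / p) - 1"
  have d: "d > 0"
    using assms powr_less_mono2[of "1/p" 1 K] by (simp add: d_def)
  have Kd: "(1 + d) powr p = K"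
    using assms by (simp add: d_def powr_powr)
  define C where "C = (1 / d + 1) powr p"
  have "(a + c) powr p \<le> K * a powr p + C * c powr p" if "0 \<le> a" "0 \<le> c" for a c :: real
  proof (cases "c \<le> d * a")
    case True
    have "(a + c) powr p \<le> ((1 + d) * a) powr p"
      using True that assms by (intro powr_mono2) (auto simp: algebra_simps)
    also have "\<dots> = K * a powr p"
      using that d Kd by (simp add: powr_mult)
    also have "\<dots> \<le> K * a powr p + C * c powr p"
      by (simp add: C_def)
    finally show ?thesis .
  next
    case False
    hence "a \<le> c / d" using d by (simp add: field_simps)
    hence "(a + c) powr p \<le> ((1 / d + 1) * c) powr p"
      using that assms by (intro powr_mono2) (auto simp: algebra_simps)
    also have "\<dots> = C * c powr p"
      using that d by (simp add: powr_mult C_def)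
    also have "\<dots> \<le> K * a powr p + C * c powr p"
      using assms by simp
    finally show ?thesis .
  qed
  thus ?thesis using that[of C] by (simp add: C_def)
qed

text \<open>The weighted arithmetic-geometric mean inequality for \<open>z\<^sup>s\<close> and 1. It replaces the
  inequalities of Jensen and Lyapunov below, because the means involved are
  normalised to 1.\<close>

lemma powr_le_interpolate:
  fixes z t s :: real
  assumes "0 \<le> z" "0 < t" "t \<le> 1"
  shows "z powr (t * s) \<le> t * z powr s + (1 - t)"
proof (cases "z = 0")
  case False
  thus ?thesis
    using Youngs_inequality_0[of t "1 - t" "z powr s" 1] assms
    by (simp add: powr_powr mult.commute)
qed (use assms in auto)

lemma powr_eq_mult_powr:
  fixes x q :: real
  assumes "0 \<le> x"
  shows "x powr q = x * x powr (q - 1)"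
  using assms powr_add[of x 1 "q - 1"] by simp

lemma sum_powr_le_powr_sum:
  fixes x :: "'i \<Rightarrow> real" and q :: real
  assumes "finite I" "\<And>i. i \<in> I \<Longrightarrow> 0 \<le> x i" "1 \<le> q"
  shows "(\<Sum>i\<in>I. x i powr q) \<le> (\<Sum>i\<in>I. x i) powr q"
proof -
  define s where "s = (\<Sum>i\<in>I. x i)"
  have "(\<Sum>i\<in>I. x i powr q) \<le> (\<Sum>i\<in>I. x i * s powr (q - 1))"
  proof (rule sum_mono)
    fix i assume i: "i \<in> I"
    have "x i \<le> s" unfolding s_def
      using assms i by (intro member_le_sum) auto
    thus "x i powr q \<le> x i * s powr (q - 1)"
      using assms i by (subst powr_eq_mult_powr) (auto intro!: mult_left_mono powr_mono2)
  qed
  also have "\<dots> = s powr q"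
    using assms by (subst (2) powr_eq_mult_powr) (auto simp: s_def sum_distrib_right intro: sum_nonneg)
  finally show ?thesis by (simp add: s_def)
qed

text \<open>Each factor \<open>x\<^sub>i\<close> of \<open>s\<^sup>q = \<Sum> x\<^sub>i s\<^sup>q\<^sup>-\<^sup>1\<close> is separated from the rest of the sum, so that
  independence applies to every mixed term.\<close>

lemma powr_sum_le:
  fixes x :: "'i \<Rightarrow> real" and q K C :: real
  assumes I: "finite I" "\<And>i. i \<in> I \<Longrightarrow> 0 \<le> x i"
    and KC: "\<And>a c :: real. 0 \<le> a \<Longrightarrow> 0 \<le> c \<Longrightarrow>
      (a + c) powr (q - 1) \<le> K * a powr (q - 1) + C * c powr (q - 1)"
  shows "(\<Sum>i\<in>I. x i) powr q
    \<le> (\<Sum>i\<in>I. K * x i powr q + C * (x i * (\<Sum>k\<in>I - {i}. x k) powr (q - 1)))"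
proof -
  define s where "s = (\<Sum>i\<in>I. x i)"
  have "s powr q = (\<Sum>i\<in>I. x i * s powr (q - 1))"
    using I by (subst powr_eq_mult_powr) (auto simp: s_def sum_distrib_right intro: sum_nonneg)
  also have "\<dots> \<le> (\<Sum>i\<in>I. K * x i powr q + C * (x i * (\<Sum>k\<in>I - {i}. x k) powr (q - 1)))"
  proof (rule sum_mono)
    fix i assume i: "i \<in> I"
    have s: "s = x i + (\<Sum>k\<in>I - {i}. x k)"
      unfolding s_def using I i by (subst sum.remove[of I i]) auto
    have "0 \<le> (\<Sum>k\<in>I - {i}. x k)"
      using I by (intro sum_nonneg) auto
    hence "s powr (q - 1) \<le> K * x i powr (q - 1) + C * (\<Sum>k\<in>I - {i}. x k) powr (q - 1)"
      unfolding s using I i by (intro KC) auto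
    hence "x i * s powr (q - 1)
      \<le> x i * (K * x i powr (q - 1) + C * (\<Sum>k\<in>I - {i}. x k) powr (q - 1))"
      using I i by (intro mult_left_mono) auto
    thus "x i * s powr (q - 1)
      \<le> K * x i powr q + C * (x i * (\<Sum>k\<in>I - {i}. x k) powr (q - 1))"
      using I i powr_eq_mult_powr[of "x i" q] by (simp add: algebra_simps)
  qed
  finally show ?thesis by (simp add: s_def)
qed

section \<open>The tree recursion\<close>

lemma finite_words_of_length: "finite (words_of_length b n)"
  using finite_lists_length_eq[of "{..<b}" n]
  by (simp add: words_of_length_def conj_commute)

lemma cascade_0 [simp]: "cascade b V 0 \<omega> = 1"
proof -
  have "words_of_length b 0 = {[]}" by (auto simp: words_of_length_def)
  thus ?thesis by (simp add: cascade_def)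
qed

lemma cascade_Suc:
  "cascade b V (Suc n) \<omega> = (\<Sum>j<b. V [j] \<omega> * cascade b (\<lambda>w. V (j # w)) n \<omega>) / real b"
proof -
  have words: "words_of_length b (Suc n) = (\<lambda>(j, w). j # w) ` ({..<b} \<times> words_of_length b n)"
    by (force simp: words_of_length_def length_Suc_conv)
  have path: "(\<Prod>m=1..Suc n. V (take m (j # w)) \<omega>)
      = V [j] \<omega> * (\<Prod>m=1..n. V (j # take m w) \<omega>)" for j w
  proof -
    have "(\<Prod>m=1..Suc n. V (take m (j # w)) \<omega>) =
        V (take 1 (j # w)) \<omega> * (\<Prod>m=Suc 1..Suc n. V (take m (j # w)) \<omega>)"
      by (subst prod.atLeast_Suc_atMost) auto
    also have "(\<Prod>m=Suc 1..Suc n. V (take m (j # w)) \<omega>) = (\<Prod>m=1..n. V (j # take m w) \<omega>)"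
      by (subst prod.shift_bounds_cl_Suc_ivl) simp
    finally show ?thesis by simp
  qed
  have "(\<Sum>j\<in>words_of_length b (Suc n). \<Prod>m=1..Suc n. V (take m j) \<omega>)
     = (\<Sum>(j, w)\<in>{..<b} \<times> words_of_length b n. \<Prod>m=1..Suc n. V (take m (j # w)) \<omega>)"
    unfolding words by (subst sum.reindex) (auto simp: inj_on_def case_prod_unfold simp del: take_Suc_Cons)
  also have "\<dots> = (\<Sum>j<b. \<Sum>w\<in>words_of_length b n. V [j] \<omega> * (\<Prod>m=1..n. V (j # take m w) \<omega>))"
    unfolding path by (simp add: sum.cartesian_product)
  finally show ?thesis
    unfolding cascade_def by (simp add: sum_distrib_left sum_divide_distrib mult.commute)
qed

lemma cascade_nonneg: "(\<And>w. 0 \<le> V w \<omega>) \<Longrightarrow> 0 \<le> cascade b V n \<omega>"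
  unfolding cascade_def by (intro divide_nonneg_nonneg sum_nonneg prod_nonneg) auto

text \<open>A cascade reads its weights at non-empty words only, the index set of
  the independent copies.\<close>

lemma take_in_nonempty_words:
  "w \<in> words_of_length b n \<Longrightarrow> m \<in> {1..n} \<Longrightarrow> take m w \<in> nonempty_words b"
  using set_take_subset[of m w] by (auto simp: words_of_length_def nonempty_words_def)

lemma cascade_cong:
  "(\<And>w. w \<in> nonempty_words b \<Longrightarrow> V w \<omega> = V' w \<omega>') \<Longrightarrow> cascade b V n \<omega> = cascade b V' n \<omega>'"
  unfolding cascade_def
  by (intro arg_cong2[where f = "(/)"] sum.cong prod.cong refl) (blast intro: take_in_nonempty_words)+

lemma borel_measurable_cascade:
  "(\<And>w. w \<in> nonempty_words b \<Longrightarrow> V w \<in> borel_measurable M) \<Longrightarrow> cascade b V n \<in> borel_measurable M"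
  unfolding cascade_def
  by (intro borel_measurable_divide borel_measurable_sum borel_measurable_prod borel_measurable_const)
     (blast intro: take_in_nonempty_words)

lemma Cons_in_nonempty_words: "j < b \<Longrightarrow> w \<in> nonempty_words b \<Longrightarrow> j # w \<in> nonempty_words b"
  and singleton_in_nonempty_words: "j < b \<Longrightarrow> [j] \<in> nonempty_words b"
  by (auto simp: nonempty_words_def)

section \<open>Independence\<close>

text \<open>The form in which independence is used throughout: a subtree, or a union of subtrees,
  is a block of indices, and a branch of the cascade is a function of one block.\<close>

lemma (in prob_space) indep_vars_nn_integral_disjoint_blocks:
  fixes V :: "'i \<Rightarrow> 'a \<Rightarrow> 'c" and F G :: "('i \<Rightarrow> 'c) \<Rightarrow> ennreal"
  assumes V: "indep_vars M' V I" and AB: "A \<inter> B = {}" "A \<subseteq> I" "B \<subseteq> I"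
    and F: "F \<in> borel_measurable (PiM A M')" and G: "G \<in> borel_measurable (PiM B M')"
  shows "(\<integral>\<^sup>+\<omega>. F (restrict (\<lambda>i. V i \<omega>) A) * G (restrict (\<lambda>i. V i \<omega>) B) \<partial>M)
    = (\<integral>\<^sup>+\<omega>. F (restrict (\<lambda>i. V i \<omega>) A) \<partial>M) * (\<integral>\<^sup>+\<omega>. G (restrict (\<lambda>i. V i \<omega>) B) \<partial>M)"
proof -
  let ?F = "\<lambda>\<omega>. F (restrict (\<lambda>i. V i \<omega>) A)" and ?G = "\<lambda>\<omega>. G (restrict (\<lambda>i. V i \<omega>) B)"
  have "indep_var borel ?F borel ?G"
    using indep_var_compose[OF indep_var_restrict[OF V AB] F G] by (simp add: comp_def)
  hence "indep_vars (\<lambda>_. borel) (case_bool ?F ?G) UNIV"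
    unfolding indep_var_def by (rule indep_vars_cong[THEN iffD1, rotated -1]) (auto split: bool.split)
  from indep_vars_nn_integral[OF _ this] show ?thesis
    by (simp add: UNIV_bool mult.commute)
qed

text \<open>Non-negativity is required at every point, so that inequalities between powers may be
  applied pointwise. The almost sure version reduces to it by truncating at 0.\<close>

locale cascade_law = M: prob_space M + N: prob_space N
  for M :: "'b measure" and N :: "'a measure" +
  fixes b :: nat and W :: "'a \<Rightarrow> real"
  assumes b: "b \<ge> 2"
    and W_measurable: "W \<in> borel_measurable N"
    and W_nonneg: "0 \<le> W x"
    and W_mean: "moment N W 1 = 1"
begin

text \<open>The space \<open>M\<close> and the law of \<open>W\<close> stay fixed while the family varies: inductions on \<open>n\<close>
  run over all families at once, which makes the induction hypothesis available on every
  subtree.\<close>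

definition weights :: "(nat list \<Rightarrow> 'b \<Rightarrow> real) \<Rightarrow> bool" where
  "weights V \<longleftrightarrow> independent_copies M V (nonempty_words b) N W \<and> (\<forall>w \<omega>. 0 \<le> V w \<omega>)"

text \<open>One generation multiplies the \<open>q\<close>-th moment by this factor, up to correction terms; the
  critical value is 1.\<close>

definition growth :: "real \<Rightarrow> ennreal" where
  "growth q = moment N W q / ennreal (real b powr (q - 1))"

definition branch :: "(nat list \<Rightarrow> 'b \<Rightarrow> real) \<Rightarrow> nat \<Rightarrow> nat \<Rightarrow> 'b \<Rightarrow> real" where
  "branch V n j \<omega> = V [j] \<omega> * cascade b (\<lambda>w. V (j # w)) n \<omega>"

lemma weights_nonneg: "weights V \<Longrightarrow> 0 \<le> V w \<omega>"
  by (simp add: weights_def)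

lemma weights_indep: "weights V \<Longrightarrow> M.indep_vars (\<lambda>_. borel) V (nonempty_words b)"
  by (simp add: weights_def independent_copies_def)

lemma weights_measurable: "weights V \<Longrightarrow> w \<in> nonempty_words b \<Longrightarrow> V w \<in> borel_measurable M"
  using weights_indep by (auto simp: M.indep_vars_def)

lemma cascade_measurable: "weights V \<Longrightarrow> cascade b V n \<in> borel_measurable M"
  by (rule borel_measurable_cascade) (rule weights_measurable)

lemma moment_weight:
  assumes "weights V" "w \<in> nonempty_words b"
  shows "moment M (V w) p = moment N W p"
proof -
  have law: "distr M borel (V w) = distr N borel W"
    using assms by (simp add: weights_def independent_copies_def)
  have "moment M (V w) p = (\<integral>\<^sup>+ x. ennreal (x powr p) \<partial>distr M borel (V w))"
    unfolding moment_def using weights_measurable[OF assms] by (subst nn_integral_distr) auto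
  also have "\<dots> = moment N W p"
    unfolding moment_def law using W_measurable by (subst nn_integral_distr) auto
  finally show ?thesis .
qed

text \<open>Relabelling by \<open>w \<mapsto> j # w\<close> is restriction to pairwise disjoint singleton blocks.\<close>

lemma weights_subtree:
  assumes V: "weights V" and j: "j < b"
  shows "weights (\<lambda>w. V (j # w))"
proof -
  let ?I = "nonempty_words b"
  have "M.indep_vars (\<lambda>w. PiM {j # w} (\<lambda>_. borel)) (\<lambda>w \<omega>. restrict (\<lambda>i. V i \<omega>) {j # w}) ?I"
    by (rule M.indep_vars_restrict[OF weights_indep[OF V]])
       (auto simp: disjoint_family_on_def Cons_in_nonempty_words j)
  hence "M.indep_vars (\<lambda>_. borel) (\<lambda>w \<omega>. (\<lambda>g. g (j # w)) (restrict (\<lambda>i. V i \<omega>) {j # w})) ?I"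
    by (rule M.indep_vars_compose2) auto
  thus ?thesis
    using V j by (simp add: weights_def independent_copies_def Cons_in_nonempty_words)
qed

lemma branch_nonneg: "weights V \<Longrightarrow> 0 \<le> branch V n j \<omega>"
  unfolding branch_def by (intro mult_nonneg_nonneg cascade_nonneg weights_nonneg)

lemma branch_measurable: "weights V \<Longrightarrow> j < b \<Longrightarrow> branch V n j \<in> borel_measurable M"
  unfolding branch_def
  by (intro borel_measurable_times cascade_measurable weights_subtree weights_measurable
      singleton_in_nonempty_words)

lemma cascade_Suc_branch: "cascade b V (Suc n) \<omega> = (\<Sum>j<b. branch V n j \<omega>) / real b"
  by (simp add: cascade_Suc branch_def)

text \<open>The weight at \<open>j\<close> and those strictly below \<open>j\<close> form disjoint blocks.\<close>

lemma moment_branch: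
  assumes V: "weights V" and j: "j < b"
  shows "moment M (branch V n j) p = moment N W p * moment M (cascade b (\<lambda>w. V (j # w)) n) p"
proof -
  let ?A = "{[j]}" and ?B = "(#) j ` nonempty_words b"
  define F where "F g = ennreal (g [j] powr p)" for g :: "nat list \<Rightarrow> real"
  define G where "G g = ennreal (cascade b (\<lambda>w g. g (j # w)) n g powr p)" for g :: "nat list \<Rightarrow> real"
  have F: "F \<in> borel_measurable (PiM ?A (\<lambda>_. borel))"
    unfolding F_def by measurable
  have "cascade b (\<lambda>w g. g (j # w)) n \<in> borel_measurable (PiM ?B (\<lambda>_. borel :: real measure))"
    by (rule borel_measurable_cascade) (auto intro: measurable_component_singleton)
  hence G: "G \<in> borel_measurable (PiM ?B (\<lambda>_. borel))"
    unfolding G_def by measurable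
  have Gr: "G (restrict (\<lambda>i. V i \<omega>) ?B) = ennreal (cascade b (\<lambda>w. V (j # w)) n \<omega> powr p)" for \<omega>
    unfolding G_def by (subst cascade_cong[where V' = "\<lambda>w. V (j # w)" and \<omega>' = \<omega>]) auto
  have "moment M (branch V n j) p
      = (\<integral>\<^sup>+\<omega>. F (restrict (\<lambda>i. V i \<omega>) ?A) * G (restrict (\<lambda>i. V i \<omega>) ?B) \<partial>M)"
    unfolding moment_def Gr F_def branch_def
    using weights_nonneg[OF V] weights_nonneg[OF weights_subtree[OF V j]]
    by (intro nn_integral_cong) (simp add: powr_mult cascade_nonneg ennreal_mult)
  also have "\<dots> = (\<integral>\<^sup>+\<omega>. F (restrict (\<lambda>i. V i \<omega>) ?A) \<partial>M) * (\<integral>\<^sup>+\<omega>. G (restrict (\<lambda>i. V i \<omega>) ?B) \<partial>M)"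
    by (rule M.indep_vars_nn_integral_disjoint_blocks[OF weights_indep[OF V] _ _ _ F G])
       (use j in \<open>auto simp: nonempty_words_def\<close>)
  also have "\<dots> = moment M (V [j]) p * moment M (cascade b (\<lambda>w. V (j # w)) n) p"
    unfolding Gr F_def moment_def by simp
  finally show ?thesis
    using moment_weight[OF V singleton_in_nonempty_words[OF j]] by simp
qed

text \<open>A branch depends on the words with a given first letter, the others on the
  remaining words.\<close>

lemma nn_integral_branch_times_rest:
  assumes V: "weights V" and i: "i < b"
  shows "(\<integral>\<^sup>+\<omega>. ennreal (branch V n i \<omega> * (\<Sum>k\<in>{..<b} - {i}. branch V n k \<omega>) powr p) \<partial>M)
    = moment M (branch V n i) 1 * moment M (\<lambda>\<omega>. \<Sum>k\<in>{..<b} - {i}. branch V n k \<omega>) p"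
proof -
  let ?A = "{w \<in> nonempty_words b. hd w = i}" and ?B = "{w \<in> nonempty_words b. hd w \<noteq> i}"
  \<comment> \<open>The branch as a function of the weights, so that it factors through a block.\<close>
  define X where "X j g = g [j] * cascade b (\<lambda>w g. g (j # w)) n g"
    for j and g :: "nat list \<Rightarrow> real"
  have X: "X j \<in> borel_measurable (PiM S (\<lambda>_. borel))"
    if "j < b" "\<And>w. w \<in> nonempty_words b \<Longrightarrow> hd w = j \<Longrightarrow> w \<in> S" for j S
  proof -
    have "cascade b (\<lambda>w g. g (j # w)) n \<in> borel_measurable (PiM S (\<lambda>_. borel :: real measure))"
      using that by (intro borel_measurable_cascade measurable_component_singleton)
        (auto simp: Cons_in_nonempty_words)
    moreover have "(\<lambda>g. g [j]) \<in> borel_measurable (PiM S (\<lambda>_. borel :: real measure))"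
      using that by (intro measurable_component_singleton) (auto simp: singleton_in_nonempty_words)
    ultimately show ?thesis unfolding X_def by (intro borel_measurable_times)
  qed
  have Xr: "X j (restrict (\<lambda>i. V i \<omega>) S) = branch V n j \<omega>"
    if "j < b" "\<And>w. w \<in> nonempty_words b \<Longrightarrow> hd w = j \<Longrightarrow> w \<in> S" for j S \<omega>
  proof -
    have "[j] \<in> S" "\<And>w. w \<in> nonempty_words b \<Longrightarrow> j # w \<in> S"
      using that by (auto simp: singleton_in_nonempty_words Cons_in_nonempty_words)
    thus ?thesis unfolding X_def branch_def
      by (subst cascade_cong[where V' = "\<lambda>w. V (j # w)" and \<omega>' = \<omega>]) auto
  qed
  define F where "F g = ennreal (X i g)" for g
  define G where "G g = ennreal ((\<Sum>k\<in>{..<b} - {i}. X k g) powr p)" for g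
  have F: "F \<in> borel_measurable (PiM ?A (\<lambda>_. borel))"
    unfolding F_def using i by (intro measurable_compose[OF X measurable_ennreal]) auto
  have "(\<lambda>g. \<Sum>k\<in>{..<b} - {i}. X k g) \<in> borel_measurable (PiM ?B (\<lambda>_. borel))"
    by (intro borel_measurable_sum X) auto
  hence G: "G \<in> borel_measurable (PiM ?B (\<lambda>_. borel))"
    unfolding G_def by measurable
  have Fr: "F (restrict (\<lambda>i. V i \<omega>) ?A) = ennreal (branch V n i \<omega>)" for \<omega>
    unfolding F_def using i by (subst Xr) auto
  have Gr: "G (restrict (\<lambda>i. V i \<omega>) ?B) =
      ennreal ((\<Sum>k\<in>{..<b} - {i}. branch V n k \<omega>) powr p)" for \<omega>
    unfolding G_def by (subst sum.cong[OF refl Xr]) auto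
  have "(\<integral>\<^sup>+\<omega>. F (restrict (\<lambda>i. V i \<omega>) ?A) * G (restrict (\<lambda>i. V i \<omega>) ?B) \<partial>M)
      = (\<integral>\<^sup>+\<omega>. F (restrict (\<lambda>i. V i \<omega>) ?A) \<partial>M) * (\<integral>\<^sup>+\<omega>. G (restrict (\<lambda>i. V i \<omega>) ?B) \<partial>M)"
    by (rule M.indep_vars_nn_integral_disjoint_blocks[OF weights_indep[OF V] _ _ _ F G]) auto
  thus ?thesis
    unfolding Fr Gr moment_def using branch_nonneg[OF V] by (simp add: ennreal_mult)
qed

section \<open>Moment recursions\<close>

lemma moment_cascade_Suc:
  assumes V: "weights V"
  shows "moment M (cascade b V (Suc n)) p
    = ennreal (real b powr (-p)) * moment M (\<lambda>\<omega>. \<Sum>j<b. branch V n j \<omega>) p"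
proof -
  have "moment M (cascade b V (Suc n)) p
    = (\<integral>\<^sup>+\<omega>. ennreal (real b powr (-p)) * ennreal ((\<Sum>j<b. branch V n j \<omega>) powr p) \<partial>M)"
    unfolding moment_def cascade_Suc_branch using branch_nonneg[OF V]
    by (intro nn_integral_cong)
      (simp add: powr_divide sum_nonneg powr_minus field_simps flip: ennreal_mult)
  also have "\<dots> = ennreal (real b powr (-p)) * moment M (\<lambda>\<omega>. \<Sum>j<b. branch V n j \<omega>) p"
    unfolding moment_def
    by (intro nn_integral_cmult measurable_compose[OF _ measurable_ennreal] powr_real_measurable
        borel_measurable_sum branch_measurable[OF V] borel_measurable_const) simp
  finally show ?thesis .
qed

lemma growth_eq: "growth q = ennreal (real b powr (-q)) * (of_nat b * moment N W q)"
proof -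
  have "inverse (ennreal (real b powr (q - 1))) = ennreal (real b powr (-q) * real b)"
    using b by (simp add: inverse_ennreal powr_diff powr_minus field_simps)
  also have "\<dots> = ennreal (real b powr (-q)) * of_nat b"
    by (simp add: ennreal_mult ennreal_of_nat_eq_real_of_nat)
  finally show ?thesis
    unfolding growth_def by (simp add: divide_ennreal_def mult_ac)
qed

lemma moment_cascade_0: "moment M (cascade b V 0) p = 1"
  by (simp add: moment_def M.emeasure_space_1)

lemma moment_cascade_1: "weights V \<Longrightarrow> moment M (cascade b V n) 1 = 1"
proof (induction n arbitrary: V)
  case (Suc n)
  have branch: "moment M (branch V n j) 1 = 1" if "j < b" for j
    using moment_branch[OF Suc.prems that] Suc.IH[OF weights_subtree[OF Suc.prems that]] W_mean
    by simp
  have "moment M (\<lambda>\<omega>. \<Sum>j<b. branch V n j \<omega>) 1 = (\<Sum>j<b. moment M (branch V n j) 1)"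
    unfolding moment_def using branch_nonneg[OF Suc.prems] branch_measurable[OF Suc.prems]
    by (subst nn_integral_sum[symmetric]) (auto simp: sum_nonneg intro!: nn_integral_cong)
  also have "\<dots> = of_nat b" using branch by simp
  finally show ?case
    unfolding moment_cascade_Suc[OF Suc.prems] using b
    by (simp add: ennreal_of_nat_eq_real_of_nat powr_minus flip: ennreal_mult)
qed (rule moment_cascade_0)

lemma moment_branch_1: "weights V \<Longrightarrow> j < b \<Longrightarrow> moment M (branch V n j) 1 = 1"
  by (simp add: moment_branch moment_cascade_1 weights_subtree W_mean)

lemma moment_cascade_le_1:
  assumes V: "weights V" and p: "0 < p" "p \<le> 1"
  shows "moment M (cascade b V n) p \<le> 1"
proof -
  have [measurable]: "cascade b V n \<in> borel_measurable M"
    by (rule cascade_measurable[OF V])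
  have nonneg: "0 \<le> cascade b V n \<omega>" for \<omega>
    by (intro cascade_nonneg weights_nonneg V)
  have "moment M (cascade b V n) p
    \<le> (\<integral>\<^sup>+\<omega>. ennreal p * ennreal (cascade b V n \<omega> powr 1) + ennreal (1 - p) \<partial>M)"
    unfolding moment_def
  proof (rule nn_integral_mono)
    fix \<omega>
    show "ennreal (cascade b V n \<omega> powr p)
        \<le> ennreal p * ennreal (cascade b V n \<omega> powr 1) + ennreal (1 - p)"
      using powr_le_interpolate[of "cascade b V n \<omega>" p 1] nonneg[of \<omega>] p
      by (simp add: ennreal_leI flip: ennreal_mult ennreal_plus)
  qed
  also have "\<dots> = ennreal p * moment M (cascade b V n) 1 + ennreal (1 - p)"
    unfolding moment_def by (subst nn_integral_add) (auto simp: nn_integral_cmult M.emeasure_space_1)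
  also have "\<dots> = 1"
    using p by (simp add: moment_cascade_1[OF V] flip: ennreal_plus)
  finally show ?thesis .
qed

text \<open>The bound also covers \<open>growth q = \<infinity>\<close>, where it says that all moments from
  generation 1 on are infinite.\<close>

lemma growth_power_le_moment_cascade:
  assumes q: "1 \<le> q"
  shows "weights V \<Longrightarrow> growth q ^ n \<le> moment M (cascade b V n) q"
proof (induction n arbitrary: V)
  case (Suc n)
  note V = Suc.prems
  have "of_nat b * moment N W q * growth q ^ n = (\<Sum>j<b. moment N W q * growth q ^ n)"
    by (simp add: mult_ac)
  also have "\<dots> \<le> (\<Sum>j<b. moment M (branch V n j) q)"
    using Suc.IH[OF weights_subtree[OF V]] moment_branch[OF V]
    by (intro sum_mono) (auto intro!: mult_left_mono)
  also have "\<dots> = (\<integral>\<^sup>+\<omega>. (\<Sum>j<b. ennreal (branch V n j \<omega> powr q)) \<partial>M)"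
    unfolding moment_def using branch_measurable[OF V]
    by (intro nn_integral_sum[symmetric]) auto
  also have "\<dots> \<le> moment M (\<lambda>\<omega>. \<Sum>j<b. branch V n j \<omega>) q"
    unfolding moment_def using branch_nonneg[OF V] q
    by (intro nn_integral_mono) (auto intro!: ennreal_leI sum_powr_le_powr_sum)
  finally have "ennreal (real b powr (-q)) * (of_nat b * moment N W q * growth q ^ n)
      \<le> moment M (cascade b V (Suc n)) q"
    unfolding moment_cascade_Suc[OF V] by (rule mult_left_mono) auto
  thus ?case by (simp add: growth_eq mult_ac)
qed (simp add: moment_cascade_0)

text \<open>In the mixed terms the branch has mean 1, and the remaining sum is at most the full sum
  because the omitted branch is non-negative. The powers of \<open>b\<close> then combine to \<open>growth q\<close> in
  the diagonal terms and to the normalisation of the \<open>(q - 1)\<close>-th moment in the mixed ones.\<close>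

lemma moment_cascade_Suc_le:
  assumes V: "weights V" and q: "1 < q" and K: "0 \<le> K" and C: "0 \<le> C"
    and KC: "\<And>a c :: real. 0 \<le> a \<Longrightarrow> 0 \<le> c \<Longrightarrow>
      (a + c) powr (q - 1) \<le> K * a powr (q - 1) + C * c powr (q - 1)"
    and B: "\<And>j. j < b \<Longrightarrow> moment M (cascade b (\<lambda>w. V (j # w)) n) q \<le> B"
    and A: "moment M (cascade b V (Suc n)) (q - 1) \<le> A"
  shows "moment M (cascade b V (Suc n)) q \<le> ennreal K * growth q * B + ennreal C * A"
proof -
  let ?X = "branch V n" and ?S = "\<lambda>\<omega>. \<Sum>j<b. branch V n j \<omega>"
  let ?R = "\<lambda>i \<omega>. \<Sum>k\<in>{..<b} - {i}. branch V n k \<omega>"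
  note X_nonneg = branch_nonneg[OF V] and X_meas [measurable] = branch_measurable[OF V]
  have R_meas: "?R i \<in> borel_measurable M" for i
    by (intro borel_measurable_sum X_meas) auto
  have rest: "(\<integral>\<^sup>+\<omega>. ennreal (?X i \<omega> * ?R i \<omega> powr (q - 1)) \<partial>M) \<le> moment M ?S (q - 1)"
    if i: "i < b" for i
  proof -
    have "(\<integral>\<^sup>+\<omega>. ennreal (?X i \<omega> * ?R i \<omega> powr (q - 1)) \<partial>M) = moment M (?R i) (q - 1)"
      using nn_integral_branch_times_rest[OF V i] moment_branch_1[OF V i] by simp
    also have "\<dots> \<le> moment M ?S (q - 1)"
      unfolding moment_def using q X_nonneg
      by (intro nn_integral_mono ennreal_leI powr_mono2 sum_mono2 sum_nonneg) auto
    finally show ?thesis .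
  qed
  have "moment M ?S q \<le> (\<integral>\<^sup>+\<omega>. (\<Sum>i<b. ennreal K * ennreal (?X i \<omega> powr q)
      + ennreal C * ennreal (?X i \<omega> * ?R i \<omega> powr (q - 1))) \<partial>M)"
    unfolding moment_def
  proof (rule nn_integral_mono)
    fix \<omega>
    have "ennreal (?S \<omega> powr q)
        \<le> ennreal (\<Sum>i<b. K * ?X i \<omega> powr q + C * (?X i \<omega> * ?R i \<omega> powr (q - 1)))"
      using X_nonneg KC by (intro ennreal_leI powr_sum_le) auto
    also have "\<dots> = (\<Sum>i<b. ennreal K * ennreal (?X i \<omega> powr q)
      + ennreal C * ennreal (?X i \<omega> * ?R i \<omega> powr (q - 1)))"
      using K C X_nonneg
      by (subst sum_ennreal[symmetric]) (auto simp: ennreal_mult)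
    finally show "ennreal (?S \<omega> powr q) \<le> (\<Sum>i<b. ennreal K * ennreal (?X i \<omega> powr q)
      + ennreal C * ennreal (?X i \<omega> * ?R i \<omega> powr (q - 1)))" .
  qed
  also have "\<dots> = (\<Sum>i<b. ennreal K * moment M (?X i) q
      + ennreal C * (\<integral>\<^sup>+\<omega>. ennreal (?X i \<omega> * ?R i \<omega> powr (q - 1)) \<partial>M))"
    unfolding moment_def using X_meas R_meas
    by (subst nn_integral_sum) (auto simp: nn_integral_add nn_integral_cmult)
  also have "\<dots> \<le> (\<Sum>i<b. ennreal K * (moment N W q * B) + ennreal C * moment M ?S (q - 1))"
    using rest B moment_branch[OF V]
    by (intro sum_mono add_mono mult_left_mono) (auto intro!: mult_left_mono)
  also have "\<dots> = ennreal K * (of_nat b * moment N W q) * B + of_nat b * ennreal C * moment M ?S (q - 1)"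
    by (simp add: algebra_simps)
  finally have "moment M (cascade b V (Suc n)) q \<le> ennreal (real b powr (-q)) *
      (ennreal K * (of_nat b * moment N W q) * B + of_nat b * ennreal C * moment M ?S (q - 1))"
    unfolding moment_cascade_Suc[OF V] by (rule mult_left_mono) auto
  also have "\<dots> = ennreal K * growth q * B
      + ennreal C * (ennreal (real b powr (-q)) * of_nat b * moment M ?S (q - 1))"
    unfolding growth_eq by (simp add: algebra_simps)
  also have "ennreal (real b powr (-q)) * of_nat b = ennreal (real b powr (-(q - 1)))"
    using b by (simp add: ennreal_of_nat_eq_real_of_nat powr_diff powr_minus field_simps flip: ennreal_mult)
  also have "\<dots> * moment M ?S (q - 1) = moment M (cascade b V (Suc n)) (q - 1)"
    by (rule moment_cascade_Suc[OF V, symmetric])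
  finally show ?thesis
    using A by (meson add_left_mono mult_left_mono order_trans zero_le)
qed

section \<open>Subcritical and supercritical growth\<close>

text \<open>With \<open>W\<close> as a probability density, \<open>growth s\<close> is the mean of \<open>(W / b)\<^sup>s\<^sup>-\<^sup>1\<close>. Interpolating
  between the exponents 0 and \<open>q - 1\<close> bounds \<open>growth r\<close> by a convex combination of 1 and
  \<open>growth q\<close>, with positive weight on the latter.\<close>

lemma growth_less_1_downward:
  assumes r: "1 < r" "r \<le> q" and q: "growth q < 1"
  shows "growth r < 1"
proof -
  have growth_integral: "growth s = (\<integral>\<^sup>+x. ennreal (W x * (W x / real b) powr (s - 1)) \<partial>N)" for s
  proof -
    have "growth s = (\<integral>\<^sup>+x. ennreal (real b powr (1 - s)) * ennreal (W x powr s) \<partial>N)"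
      unfolding growth_eq moment_def using W_measurable b
      by (subst nn_integral_cmult)
        (auto simp: ennreal_of_nat_eq_real_of_nat powr_diff powr_minus field_simps
          simp flip: ennreal_mult mult.assoc)
    also have "\<dots> = (\<integral>\<^sup>+x. ennreal (W x * (W x / real b) powr (s - 1)) \<partial>N)"
    proof (rule nn_integral_cong)
      fix x
      have "real b powr (1 - s) * W x powr s = W x * (W x / real b) powr (s - 1)"
        using W_nonneg[of x] b
        by (subst powr_eq_mult_powr) (auto simp: powr_divide powr_diff field_simps)
      thus "ennreal (real b powr (1 - s)) * ennreal (W x powr s)
        = ennreal (W x * (W x / real b) powr (s - 1))"
        by (simp flip: ennreal_mult)
    qed
    finally show ?thesis .
  qed
  define t where "t = (r - 1) / (q - 1)"
  have t: "0 < t" "t \<le> 1" "t * (q - 1) = r - 1"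
    using r by (auto simp: t_def)
  have [measurable]: "W \<in> borel_measurable N" by (rule W_measurable)
  have "growth r \<le> (\<integral>\<^sup>+x. ennreal t * ennreal (W x * (W x / real b) powr (q - 1))
      + ennreal (1 - t) * ennreal (W x powr 1) \<partial>N)"
    unfolding growth_integral
  proof (rule nn_integral_mono)
    fix x
    have "W x * (W x / real b) powr (r - 1) \<le> W x * (t * (W x / real b) powr (q - 1) + (1 - t))"
      using powr_le_interpolate[of "W x / real b" t "q - 1"] W_nonneg[of x] t
      by (intro mult_left_mono) auto
    thus "ennreal (W x * (W x / real b) powr (r - 1)) \<le>
      ennreal t * ennreal (W x * (W x / real b) powr (q - 1)) + ennreal (1 - t) * ennreal (W x powr 1)"
      using W_nonneg[of x] t
      by (auto simp: distrib_left mult_ac intro!: ennreal_leI simp flip: ennreal_mult ennreal_plus)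
  qed
  also have "\<dots> = ennreal t * growth q + ennreal (1 - t) * moment N W 1"
    unfolding growth_integral moment_def
    by (subst nn_integral_add) (auto simp: nn_integral_cmult)
  also have "\<dots> < 1"
  proof -
    obtain g where g: "growth q = ennreal g" "0 \<le> g" "g < 1"
      using q by (cases "growth q") (auto simp: ennreal_less_one_iff)
    have "t * g + (1 - t) < 1" using t g by simp
    thus ?thesis
      using t g unfolding W_mean
      by (simp add: ennreal_less_one_iff flip: ennreal_mult ennreal_plus)
  qed
  finally show ?thesis .
qed

text \<open>The recursion \<open>u \<mapsto> K g u + C A\<close> is a contraction, and a bound above its fixed point and
  above the initial value 1 is preserved.\<close>

lemma bounded_moment_step:
  assumes q: "1 < q" "growth q < 1"
    and A: "0 \<le> A" "\<And>V n. weights V \<Longrightarrow> moment M (cascade b V n) (q - 1) \<le> ennreal A"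
  shows "\<exists>B\<ge>0. \<forall>V n. weights V \<longrightarrow> moment M (cascade b V n) q \<le> ennreal B"
proof -
  obtain g where g: "growth q = ennreal g" "0 \<le> g" "g < 1"
    using q by (cases "growth q") (auto simp: ennreal_less_one_iff)
  \<comment> \<open>This choice gives both \<open>K > 1\<close> and \<open>K g < 1\<close> for every \<open>g < 1\<close>.\<close>
  define K where "K = 2 / (1 + g)"
  have K: "1 < K" "K * g < 1" using g by (auto simp: K_def field_simps)
  obtain C where C: "0 \<le> C"
    "\<And>a c :: real. 0 \<le> a \<Longrightarrow> 0 \<le> c \<Longrightarrow>
      (a + c) powr (q - 1) \<le> K * a powr (q - 1) + C * c powr (q - 1)"
    using powr_add_le_almost_add_powr[of "q - 1" K] q K by auto
  define B where "B = 1 + C * A / (1 - K * g)"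
  have B: "1 \<le> B" using C A K by (auto simp: B_def)
  have step: "K * g * B + C * A \<le> B"
  proof -
    have "(1 - K * g) * B = (1 - K * g) + C * A"
      using K by (simp add: B_def distrib_left)
    thus ?thesis using K by (simp add: algebra_simps)
  qed
  have "moment M (cascade b V n) q \<le> ennreal B" if "weights V" for V n
    using that
  proof (induction n arbitrary: V)
    case 0
    show ?case using B by (subst moment_cascade_0) simp
  next
    case (Suc n)
    have "moment M (cascade b V (Suc n)) q
        \<le> ennreal K * growth q * ennreal B + ennreal C * ennreal A"
      using Suc.IH[OF weights_subtree[OF Suc.prems]] K C A(2)[OF Suc.prems]
      by (intro moment_cascade_Suc_le[OF Suc.prems q(1)]) auto
    also have "\<dots> = ennreal (K * g * B + C * A)"
      using K g B C A by (simp add: ennreal_mult ennreal_plus)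
    also have "\<dots> \<le> ennreal B" using step by (rule ennreal_leI)
    finally show ?case .
  qed
  thus ?thesis using B by (intro exI[of _ B]) auto
qed

text \<open>The integer \<open>k\<close> counts how often the exponent can be lowered by 1 before it is at
  most 1.\<close>

lemma bounded_moment:
  assumes "0 < q" "q \<le> real k + 1" "q \<le> 1 \<or> growth q < 1"
  shows "\<exists>B\<ge>0. \<forall>V n. weights V \<longrightarrow> moment M (cascade b V n) q \<le> ennreal B"
  using assms
proof (induction k arbitrary: q)
  case 0
  thus ?case using moment_cascade_le_1 by (intro exI[of _ 1]) auto
next
  case (Suc k)
  show ?case
  proof (cases "q \<le> 1")
    case True
    thus ?thesis using moment_cascade_le_1 Suc.prems by (intro exI[of _ 1]) auto
  next
    case False
    have "q - 1 \<le> 1 \<or> growth (q - 1) < 1"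
      using growth_less_1_downward[of "q - 1" q] Suc.prems False by force
    then obtain A where "0 \<le> A"
      "\<And>V n. weights V \<Longrightarrow> moment M (cascade b V n) (q - 1) \<le> ennreal A"
      using Suc.IH[of "q - 1"] Suc.prems False by auto
    thus ?thesis using bounded_moment_step[of q A] Suc.prems False by auto
  qed
qed

text \<open>The additive error of the recursion is at most 1 per generation, hence at most the
  current power of \<open>g \<ge> 1\<close>; it accumulates to the factor \<open>n + 1\<close>.\<close>

lemma moment_cascade_le_linear_times_power:
  assumes q: "1 < q" "q \<le> 2" and g: "growth q = ennreal g" "1 \<le> g"
  shows "weights V \<Longrightarrow> moment M (cascade b V n) q \<le> ennreal (real (Suc n) * g ^ n)"
proof (induction n arbitrary: V)
  case 0
  show ?case by (subst moment_cascade_0) simp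
next
  case (Suc n)
  have "moment M (cascade b V (Suc n)) q
      \<le> ennreal 1 * growth q * ennreal (real (Suc n) * g ^ n) + ennreal 1 * 1"
    using Suc.IH[OF weights_subtree[OF Suc.prems]] q
      powr_add_le_add_powr[where p = "q - 1"] moment_cascade_le_1[OF Suc.prems, of "q - 1"]
    by (intro moment_cascade_Suc_le[OF Suc.prems q(1)]) auto
  also have "\<dots> = ennreal (g * (real (Suc n) * g ^ n) + 1)"
    using g by (subst ennreal_plus) (auto simp: ennreal_mult)
  also have "\<dots> \<le> ennreal (real (Suc (Suc n)) * g ^ Suc n)"
  proof (rule ennreal_leI)
    have "1 \<le> g ^ Suc n" by (rule one_le_power[OF g(2)])
    thus "g * (real (Suc n) * g ^ n) + 1 \<le> real (Suc (Suc n)) * g ^ Suc n"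
      by (simp add: algebra_simps)
  qed
  finally show ?case .
qed

end

section \<open>Growth rates\<close>

lemma ext_ln_mono: "x \<le> y \<Longrightarrow> ext_ln x \<le> ext_ln y"
  by (cases x; cases y) (auto simp: ext_ln_def top_unique)

lemma ext_ln_ennreal: "0 < x \<Longrightarrow> ext_ln (ennreal x) = ereal (ln x)"
  by (simp add: ext_ln_def)

lemma ext_ln_power_divide:
  assumes n: "0 < n" and x: "1 < x"
  shows "ext_ln (x ^ n) / ereal (real n) = ext_ln x"
proof (cases x)
  case (real r)
  hence "1 < r" using x by (simp add: ennreal_less_iff flip: ennreal_1)
  thus ?thesis using n real by (simp add: ennreal_power ext_ln_ennreal ln_realpow)
next
  case top
  thus ?thesis using n by (simp add: ext_ln_def power_eq_top_ennreal)
qed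

lemma tendsto_ln_linear_times_power:
  fixes r :: real
  assumes r: "0 < r"
  shows "(\<lambda>n. ext_ln (ennreal (real (Suc n) * r ^ n)) / ereal (real n)) \<longlonglongrightarrow> ereal (ln r)"
proof -
  have "(\<lambda>n. ln (real (Suc n)) / real n + ln r) \<longlonglongrightarrow> 0 + ln r"
    by (intro tendsto_add tendsto_const) real_asymp
  hence "(\<lambda>n. ereal (ln (real (Suc n)) / real n + ln r)) \<longlonglongrightarrow> ereal (ln r)"
    by simp
  moreover have "\<forall>\<^sub>F n in sequentially. ereal (ln (real (Suc n)) / real n + ln r)
      = ext_ln (ennreal (real (Suc n) * r ^ n)) / ereal (real n)"
    using eventually_gt_at_top[of 0]
  proof eventually_elim
    case (elim n)
    have "ln (real (Suc n) * r ^ n) = ln (real (Suc n)) + real n * ln r"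
      using r by (simp add: ln_mult ln_realpow del: of_nat_Suc)
    thus ?case
      using r elim by (subst ext_ln_ennreal) (auto simp: add_divide_distrib simp del: of_nat_Suc)
  qed
  ultimately show ?thesis by (rule Lim_transform_eventually)
qed

lemma moment_cong_AE: "AE \<omega> in M. X \<omega> = Y \<omega> \<Longrightarrow> moment M X q = moment M Y q"
  unfolding moment_def by (rule nn_integral_cong_AE) auto

lemma independent_copies_max_0:
  assumes M: "prob_space M" and W: "W \<in> borel_measurable N"
    and V: "independent_copies M V I N W"
  shows "independent_copies M (\<lambda>i \<omega>. max 0 (V i \<omega>)) I N (\<lambda>x. max 0 (W x))"
proof -
  interpret prob_space M by (rule M)
  have indep: "indep_vars (\<lambda>_. borel) V I"
    and law: "\<And>i. i \<in> I \<Longrightarrow> distr M borel (V i) = distr N borel W"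
    using V by (auto simp: independent_copies_def)
  have "indep_vars (\<lambda>_. borel) (\<lambda>i \<omega>. max 0 (V i \<omega>)) I"
    by (rule indep_vars_compose2[OF indep, of "\<lambda>_. max 0"]) auto
  moreover have "distr M borel (\<lambda>\<omega>. max 0 (V i \<omega>)) = distr N borel (\<lambda>x. max 0 (W x))"
    if i: "i \<in> I" for i
  proof -
    have "V i \<in> borel_measurable M" using indep i by (auto simp: indep_vars_def)
    hence "distr M borel (\<lambda>\<omega>. max 0 (V i \<omega>)) = distr (distr M borel (V i)) borel (max 0)"
      by (subst distr_distr) (auto simp: comp_def)
    also have "\<dots> = distr N borel (\<lambda>x. max 0 (W x))"
      unfolding law[OF i] using W by (subst distr_distr) (auto simp: comp_def)
    finally show ?thesis .
  qed
  ultimately show ?thesis by (simp add: independent_copies_def)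
qed

lemma AE_copies_nonneg:
  assumes M: "prob_space M" and W: "W \<in> borel_measurable N" "AE x in N. 0 \<le> W x"
    and V: "independent_copies M V I N W" and i: "i \<in> I"
  shows "AE \<omega> in M. 0 \<le> V i \<omega>"
proof -
  interpret prob_space M by (rule M)
  have law: "distr M borel (V i) = distr N borel W"
    using V i by (auto simp: independent_copies_def)
  have "V i \<in> borel_measurable M"
    using V i by (auto simp: independent_copies_def indep_vars_def)
  hence "(AE \<omega> in M. 0 \<le> V i \<omega>) \<longleftrightarrow> (AE x in distr M borel (V i). 0 \<le> x)"
    by (subst AE_distr_iff) auto
  also have "\<dots> \<longleftrightarrow> (AE x in N. 0 \<le> W x)"
    unfolding law using W(1) by (subst AE_distr_iff) auto
  finally show ?thesis using W(2) by simp
qed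

theorem proposition1p3:
  fixes b :: nat and q :: real
    and N :: "'a measure" and W :: "'a \<Rightarrow> real"
    and M :: "'b measure" and V :: "nat list \<Rightarrow> 'b \<Rightarrow> real"
  assumes b: "b \<ge> 2"
    and N: "prob_space N"
    and W_rv: "W \<in> borel_measurable N"
    and W_nonneg: "AE x in N. W x \<ge> 0"
    and W_int: "integrable N W"
    and W_mean: "integral\<^sup>L N W = 1"
    and not_TC: "distr N borel W \<noteq> W_TC_law b"
    and M: "prob_space M"
    and V: "independent_copies M V (nonempty_words b) N W"
    and q: "q > 1"
  shows
    "(moment N W q < ennreal (real b powr (q - 1)) \<longrightarrow>
        (SUP n\<in>{1..}. moment M (cascade b V n) q) < \<infinity>) \<and>
     (moment N W q > ennreal (real b powr (q - 1)) \<longrightarrow>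
        liminf (\<lambda>n. ext_ln (moment M (cascade b V n) q) / ereal (real n))
          \<ge> ext_ln (moment N W q / ennreal (real b powr (q - 1))) \<and>
        (q \<le> 2 \<longrightarrow>
          (\<lambda>n. ext_ln (moment M (cascade b V n) q) / ereal (real n))
            \<longlonglongrightarrow> ext_ln (moment N W q / ennreal (real b powr (q - 1)))))"
proof -
  \<comment> \<open>Truncation at 0 changes the variables only on null sets.\<close>
  define W' where "W' = (\<lambda>x. max 0 (W x))"
  define V' where "V' = (\<lambda>w \<omega>. max 0 (V w \<omega>))"
  have W'_moment: "moment N W' p = moment N W p" for p
    by (rule moment_cong_AE) (use W_nonneg in \<open>auto simp: W'_def max_def\<close>)
  have V'_moment: "moment M (cascade b V' n) p = moment M (cascade b V n) p" for n p
  proof (rule moment_cong_AE)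
    have "AE \<omega> in M. \<forall>w\<in>nonempty_words b. 0 \<le> V w \<omega>"
      by (intro AE_ball_countable' countableI_type AE_copies_nonneg[OF M W_rv W_nonneg V])
    thus "AE \<omega> in M. cascade b V' n \<omega> = cascade b V n \<omega>"
      by eventually_elim (auto intro!: cascade_cong simp: V'_def)
  qed
  have "moment N W 1 = (\<integral>\<^sup>+x. ennreal (W x) \<partial>N)"
    unfolding moment_def by (rule nn_integral_cong_AE) (use W_nonneg in auto)
  also have "\<dots> = 1"
    using W_int W_nonneg W_mean by (simp add: nn_integral_eq_integral)
  finally have "moment N W' 1 = 1" by (simp add: W'_moment)
  then interpret cascade_law M N b W'
    using b M N W_rv
    by (intro cascade_law.intro cascade_law_axioms.intro) (auto simp: W'_def)
  have weights: "weights V'"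
    using independent_copies_max_0[OF M W_rv V] unfolding weights_def by (simp add: V'_def W'_def)
  define g where "g = moment N W q / ennreal (real b powr (q - 1))"
  have growth: "growth q = g"
    by (simp add: growth_def g_def W'_moment)
  have bq: "0 < real b powr (q - 1)" using b by simp
  define a where "a n = ext_ln (moment M (cascade b V n) q) / ereal (real n)" for n

  have sub: "(SUP n\<in>{1..}. moment M (cascade b V n) q) < \<infinity>"
    if "moment N W q < ennreal (real b powr (q - 1))"
  proof -
    have "g < 1"
      using that bq unfolding g_def
      by (cases "moment N W q") (auto simp: divide_ennreal ennreal_less_one_iff ennreal_less_iff)
    moreover have "q \<le> real (nat \<lceil>q\<rceil>) + 1"
      using real_nat_ceiling_ge[of q] by simp
    ultimately obtain B where "\<forall>V n. weights V \<longrightarrow> moment M (cascade b V n) q \<le> ennreal B"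
      using bounded_moment[of q "nat \<lceil>q\<rceil>"] q growth by auto
    hence "moment M (cascade b V n) q \<le> ennreal B" for n
      using weights V'_moment by metis
    hence "(SUP n\<in>{1..}. moment M (cascade b V n) q) \<le> ennreal B"
      by (intro SUP_least)
    thus ?thesis by (rule le_less_trans) simp
  qed

  have super: "ext_ln g \<le> liminf a \<and> (q \<le> 2 \<longrightarrow> a \<longlonglongrightarrow> ext_ln g)"
    if "moment N W q > ennreal (real b powr (q - 1))"
  proof -
    have g: "1 < g"
    proof (cases "moment N W q")
      case (real m)
      thus ?thesis
        using that bq unfolding g_def
        by (auto simp: divide_ennreal ennreal_less_iff simp flip: ennreal_1)
    next
      case top
      thus ?thesis by (simp add: g_def ennreal_top_divide)
    qed
    have lower: "\<forall>\<^sub>F n in sequentially. ext_ln g \<le> a n"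
      using eventually_gt_at_top[of 0]
    proof eventually_elim
      case (elim n)
      have "g ^ n \<le> moment M (cascade b V n) q"
        using growth_power_le_moment_cascade[OF _ weights, of q n] q growth V'_moment by simp
      from ereal_divide_right_mono[OF ext_ln_mono[OF this], of "ereal (real n)"]
      show "ext_ln g \<le> a n"
        using ext_ln_power_divide[OF elim g] elim by (simp add: a_def)
    qed
    have "a \<longlonglongrightarrow> ext_ln g" if q2: "q \<le> 2"
    proof (cases g)
      case (real r)
      have r: "1 < r" using g real by (simp add: ennreal_less_iff flip: ennreal_1)
      have upper: "\<forall>\<^sub>F n in sequentially.
          a n \<le> ext_ln (ennreal (real (Suc n) * r ^ n)) / ereal (real n)"
        using eventually_gt_at_top[of 0]
      proof eventually_elim
        case (elim n)
        have "moment M (cascade b V n) q \<le> ennreal (real (Suc n) * r ^ n)"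
          using moment_cascade_le_linear_times_power[OF q q2 _ _ weights, of r n]
            r real growth V'_moment by simp
        thus ?case unfolding a_def
          using elim by (intro ereal_divide_right_mono ext_ln_mono) auto
      qed
      have "ext_ln g = ereal (ln r)" using r real by (simp add: ext_ln_ennreal)
      thus ?thesis
        using tendsto_sandwich[OF lower upper tendsto_const] tendsto_ln_linear_times_power[of r] r
        by simp
    next
      case top
      hence "\<forall>\<^sub>F n in sequentially. a n = ext_ln g"
        using lower by (simp add: ext_ln_def)
      thus ?thesis by (rule tendsto_eventually)
    qed
    thus ?thesis using Liminf_bounded[OF lower] by simp
  qed
  show ?thesis using sub super unfolding a_def g_def by blast
qed

end
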